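(* Let $n\ge 2$ and let $\varrho=(\rho_1,\dots,\rho_n)\in\mathcal{D}(\mathbb{C}^2)^n$ be any $n$-tuple of single-qubit density matrices with Bloch vectors $\mathbf{r}_1,\dots,\mathbf{r}_n$ and Gram matrix $G_{\mathbf{r}_\varrho}=(\langle\mathbf{r}_k,\mathbf{r}_l\rangle)_{k,l=1}^n$. Let $\lambda_1(G_{\mathbf{r}_\varrho})\ge\lambda_2(G_{\mathbf{r}_\varrho})\ge\lambda_3(G_{\mathbf{r}_\varrho})\ge\cdots\ge\lambda_n(G_{\mathbf{r}_\varrho})$ denote the eigenvalues of $G_{\mathbf{r}_\varrho}$ in decreasing order (with $\lambda_3(G_{\mathbf{r}_\varrho}):=0$ if $n=2$). Then $$\frac{\lambda_2(G_{\mathbf{r}_\varrho})+\lambda_3(G_{\mathbf{r}_\varrho})}{n}\le \mathsf{C}_{R_1}(\varrho)\le\sqrt{\frac{\lambda_2(G_{\mathbf{r}_\varrho})+\lambda_3(G_{\mathbf{r}_\varrho})}{n}}.$$ Moreover, $\mathsf{C}_{R_1}(\varrho)\le\sqrt{2/3}$ for all $\varrho\in\mathcal{D}(\mathbb{C}^2)^n$.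
   Context: $\mathcal{D}(\mathbb{C}^2)$ is the set of $2\times2$ density matrices. The Bloch vector of $\rho\in\mathcal{D}(\mathbb{C}^2)$ is the unique $\mathbf{r}\in\mathbb{R}^3$, $\|\mathbf{r}\|\le 1$, with $\rho=\frac{1}{2}(\mathbb{1}+\mathbf{r}\cdot\boldsymbol{\sigma})$, where $\boldsymbol{\sigma}=(\sigma_x,\sigma_y,\sigma_z)$ are the Pauli matrices. The robustness of coherence of a single state relative to the standard basis $\{|0\rangle,|1\rangle\}$ is $$\mathsf{C}_R(\rho):=\min_{\tau\in\mathcal{D}(\mathbb{C}^2)}\Big\{s\ge 0 \,\Big|\, \tfrac{\rho+s\tau}{s+1}\text{ is diagonal in the standard basis}\Big\}.$$ For an $n$-tuple $\varrho=(\rho_1,\dots,\rho_n)\in\mathcal{D}(\mathbb{C}^2)^n$, $$\mathsf{C}_{R_1}(\varrho):=\min_{U\in\mathrm{U}(2)}\frac{1}{n}\sum_{j=1}^n\mathsf{C}_R(U\rho_jU^\dagger).$$ Eigenvalues are counted with multiplicity. *)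

theory Defs
  imports "HOL-Analysis.Analysis" "Jordan_Normal_Form.Char_Poly"
begin

text \<open>
  Operators on \<open>\<complex>\<^sup>2\<close> are elements of the type \<^typ>\<open>complex^2^2\<close>, where \<open>A $ i $ j\<close> is the entry in
  row \<open>i\<close> and column \<open>j\<close>. Gram matrices, whose size varies, are matrices from
  \<^theory>\<open>Jordan_Normal_Form.Matrix\<close>. An \<open>n\<close>-tuple is a function on \<^typ>\<open>nat\<close> of which only the
  values at \<open>j < n\<close> matter.
\<close>

definition dagger :: "complex^2^2 \<Rightarrow> complex^2^2" where
  "dagger A = (\<chi> i j. cnj (A $ j $ i))"

definition unitary_matrix :: "complex^2^2 \<Rightarrow> bool" where
  "unitary_matrix U \<longleftrightarrow> dagger U ** U = Finite_Cartesian_Product.mat 1 \<and>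
                        U ** dagger U = Finite_Cartesian_Product.mat 1"

definition positive_semidefinite :: "complex^2^2 \<Rightarrow> bool" where
  "positive_semidefinite A \<longleftrightarrow> dagger A = A \<and>
     (\<forall>v :: complex^2. 0 \<le> Re (\<Sum>i\<in>UNIV. cnj (v $ i) * (A *v v) $ i))"

definition density_matrix :: "complex^2^2 \<Rightarrow> bool" where
  "density_matrix \<rho> \<longleftrightarrow> positive_semidefinite \<rho> \<and> Determinants.trace \<rho> = 1"

definition pauli_x :: "complex^2^2" where
  "pauli_x = vector [vector [0, 1], vector [1, 0]]"

definition pauli_y :: "complex^2^2" where
  "pauli_y = vector [vector [0, - \<i>], vector [\<i>, 0]]"

definition pauli_z :: "complex^2^2" where
  "pauli_z = vector [vector [1, 0], vector [0, - 1]]"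

definition bloch_vector :: "complex^2^2 \<Rightarrow> real^3" where
  "bloch_vector \<rho> = (THE r. norm r \<le> 1 \<and>
     \<rho> = (1 / 2) *\<^sub>R (Finite_Cartesian_Product.mat 1
            + (r $ 1) *\<^sub>R pauli_x + (r $ 2) *\<^sub>R pauli_y + (r $ 3) *\<^sub>R pauli_z))"

definition diagonal_matrix :: "complex^2^2 \<Rightarrow> bool" where
  "diagonal_matrix A \<longleftrightarrow> (\<forall>i j. i \<noteq> j \<longrightarrow> A $ i $ j = 0)"

text \<open>
  Both quantities below are minima rather than infima, so they are rendered with
  \<^const>\<open>Least\<close>: nothing can be derived about their values before the minimum is shown
  to be attained.
\<close>

definition robustness_of_coherence :: "complex^2^2 \<Rightarrow> real" where
  "robustness_of_coherence \<rho> =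
     (LEAST s. 0 \<le> s \<and> (\<exists>\<tau>. density_matrix \<tau> \<and>
        diagonal_matrix ((1 / (s + 1)) *\<^sub>R (\<rho> + s *\<^sub>R \<tau>))))"

definition set_coherence_R1 :: "nat \<Rightarrow> (nat \<Rightarrow> complex^2^2) \<Rightarrow> real" where
  "set_coherence_R1 n \<rho> =
     (LEAST c. \<exists>U. unitary_matrix U \<and>
        c = (1 / real n) * (\<Sum>j<n. robustness_of_coherence (U ** \<rho> j ** dagger U)))"

definition bloch_gram :: "nat \<Rightarrow> (nat \<Rightarrow> complex^2^2) \<Rightarrow> real Matrix.mat" where
  "bloch_gram n \<rho> =
     Matrix.mat n n (\<lambda>(k, l). inner (bloch_vector (\<rho> k)) (bloch_vector (\<rho> l)))"

text \<open>
  The \<open>k\<close>-th largest eigenvalue (\<open>k \<ge> 1\<close>) of a matrix with real spectrum, with algebraic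
  multiplicity; it is \<open>0\<close> if \<open>k\<close> exceeds the size of the matrix.
\<close>

definition eigenvalue_desc :: "nat \<Rightarrow> real Matrix.mat \<Rightarrow> real" where
  "eigenvalue_desc k A =
     (if k \<le> dim_row A
      then rev (sorted_list_of_multiset (proots (char_poly A))) ! (k - 1)
      else 0)"

end

(*
  Conjugating by U and reading off the off-diagonal entry gives C_R = sqrt(|r|^2 - <r,u>^2), where
  the unit vector u is the axis that U rotates to the z-axis; every unit vector occurs. So C_R1 is
  the minimum over unit vectors u of the mean of sqrt(x_j), with x_j = |r_j|^2 - <r_j,u>^2 in [0,1].
  Now x <= sqrt x, while the mean of sqrt(x_j) is at most the root of the mean of the x_j. The sum
  of the x_j is tr M - <u, M u> for the second moment matrix M = sum_j r_j r_j^T. Its minimum is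
  the sum of the two smaller eigenvalues of M, which is at most 2/3 tr M <= 2n/3. The Gram matrix
  has the same spectrum as M up to zeros: by the choice of an orthonormal eigenbasis it is A A^T
  with A^T A diagonal, and char_poly (A B) and char_poly (B A) differ by a power of X.
*)
theory Submission
  imports Defs "HOL-Analysis.Cross3"
begin

no_notation vec_index (infixl \<open>$\<close> 100)

section \<open>Characteristic polynomials of AB and BA\<close>

text \<open>\<open>L * P\<close> and \<open>P * R\<close> are block triangular, with
  \<open>det L = 1\<close> and \<open>det R = X ^ m\<close>; eliminating \<open>det P\<close> gives
  the claim. A power of X on each side avoids a case split on which of \<open>n\<close> and
  \<open>m\<close> is larger.\<close>

lemma char_poly_mult_commute:
  fixes A B :: "'a :: idom Matrix.mat"
  assumes A: "A \<in> carrier_mat n m" and B: "B \<in> carrier_mat m n"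
  shows "[:0, 1:] ^ m * char_poly (A * B) = [:0, 1:] ^ n * char_poly (B * A)"
proof -
  define X :: "'a poly" where "X = [:0, 1:]"
  define C where "C = map_mat (\<lambda>a. [:a:]) A"
  define D where "D = map_mat (\<lambda>a. [:a:]) B"
  have C: "C \<in> carrier_mat n m" and D: "D \<in> carrier_mat m n"
    using A B by (auto simp: C_def D_def)
  \<comment> \<open>Row and column operations clearing the block \<open>C\<close> evaluate \<open>det P\<close> in two ways.\<close>
  define P where "P = four_block_mat (X \<cdot>\<^sub>m 1\<^sub>m n) C D (1\<^sub>m m)"
  define L where "L = four_block_mat (1\<^sub>m n) (- C) (0\<^sub>m m n) (1\<^sub>m m)"
  define R where "R = four_block_mat (1\<^sub>m n) (- C) (0\<^sub>m m n) (X \<cdot>\<^sub>m 1\<^sub>m m)"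
  have carrier [simp]: "P \<in> carrier_mat (n + m) (n + m)" "L \<in> carrier_mat (n + m) (n + m)"
      "R \<in> carrier_mat (n + m) (n + m)"
    using C D by (auto simp: P_def L_def R_def)
  have CD: "C * D = map_mat (\<lambda>a. [:a:]) (A * B)"
    unfolding C_def D_def by (rule map_poly_mult(1)[OF A B, symmetric])
  have DC: "D * C = map_mat (\<lambda>a. [:a:]) (B * A)"
    unfolding C_def D_def by (rule map_poly_mult(1)[OF B A, symmetric])
  have AB: "char_poly_matrix (A * B) = X \<cdot>\<^sub>m 1\<^sub>m n + (- C) * D"
    using A B C D CD unfolding char_poly_matrix_def X_def by (intro eq_matI) auto
  have BA: "char_poly_matrix (B * A) = D * (- C) + X \<cdot>\<^sub>m 1\<^sub>m m"
    using A B C D DC unfolding char_poly_matrix_def X_def by (intro eq_matI) auto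
  have "L * P = four_block_mat (char_poly_matrix (A * B)) (0\<^sub>m n m) D (1\<^sub>m m)"
    unfolding L_def P_def AB
    by (subst mult_four_block_mat[of _ n n _ m _ m _ _ n _ m]) (use C D in \<open>auto intro!: cong_four_block_mat\<close>)
  also have "Determinant.det \<dots> = char_poly (A * B)"
    unfolding char_poly_def using A B D
    by (subst det_four_block_mat_upper_right_zero[of _ n _ m]) auto
  finally have 1: "Determinant.det (L * P) = char_poly (A * B)" .
  have "(X \<cdot>\<^sub>m 1\<^sub>m n) * (- C) = - (X \<cdot>\<^sub>m C)" "C * (X \<cdot>\<^sub>m 1\<^sub>m m) = X \<cdot>\<^sub>m C"
    using C by (auto simp: mult_smult_assoc_mat[of _ n n _ m] mult_smult_distrib[of _ n m _ m])
  then have zero: "(X \<cdot>\<^sub>m 1\<^sub>m n) * (- C) + C * (X \<cdot>\<^sub>m 1\<^sub>m m) = 0\<^sub>m n m"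
    using C by (auto intro!: eq_matI)
  have "P * R = four_block_mat (X \<cdot>\<^sub>m 1\<^sub>m n) (0\<^sub>m n m) D (char_poly_matrix (B * A))"
    unfolding R_def P_def BA
    by (subst mult_four_block_mat[of _ n n _ m _ m _ _ n _ m])
      (use C D zero in \<open>auto intro!: cong_four_block_mat eq_matI\<close>)
  also have "Determinant.det \<dots> = X ^ n * char_poly (B * A)"
    unfolding char_poly_def using A B D
    by (subst det_four_block_mat_upper_right_zero[of _ n _ m]) auto
  finally have 2: "Determinant.det (P * R) = X ^ n * char_poly (B * A)" .
  have "Determinant.det L = 1"
    unfolding L_def using C by (subst det_four_block_mat_lower_left_zero[of _ n _ m]) auto
  moreover have "Determinant.det R = X ^ m"
    unfolding R_def using C by (subst det_four_block_mat_lower_left_zero[of _ n _ m]) auto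
  ultimately show ?thesis
    using 1 2 by (simp add: det_mult[of _ "n + m"] X_def mult.commute)
qed

section \<open>Principal axes of the second moment form\<close>

text \<open>Parseval for the basis \<open>a\<close>, \<open>b\<close>, \<open>cross3 a b\<close>.
  The case x = y splits \<open>z\<close> along and across the unit vector \<open>cross3 a b\<close>
  and expands the double cross product; polarization gives the rest.\<close>

lemma orthonormal_cross_inner:
  fixes a b x y :: "real^3"
  assumes "norm a = 1" "norm b = 1" "inner a b = 0"
  shows "inner x y = inner x a * inner y a + inner x b * inner y b
           + inner x (cross3 a b) * inner y (cross3 a b)"
proof -
  have sq: "inner z z = (inner z a)\<^sup>2 + (inner z b)\<^sup>2 + (inner z (cross3 a b))\<^sup>2" for z
  proof -
    have aa: "inner a a = 1" "inner b b = 1" "inner b a = 0"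
      using assms by (auto simp: dot_square_norm inner_commute)
    have "(norm (cross3 a b))\<^sup>2 = 1"
      using norm_cross_dot[of a b] assms by simp
    then have "inner z z = (norm (cross3 z (cross3 a b)))\<^sup>2 + (inner z (cross3 a b))\<^sup>2"
      using norm_cross_dot[of z "cross3 a b"] by (simp add: power_mult_distrib power2_norm_eq_inner)
    also have "cross3 z (cross3 a b) = inner z b *\<^sub>R a - inner z a *\<^sub>R b"
      by (simp add: Lagrange)
    also have "(norm \<dots>)\<^sup>2 = (inner z a)\<^sup>2 + (inner z b)\<^sup>2"
      unfolding power2_norm_eq_inner
      by (simp add: inner_diff_left inner_diff_right aa assms power2_eq_square)
    finally show ?thesis .
  qed
  show ?thesis
    using sq[of "x + y"] sq[of x] sq[of y]
    by (simp add: inner_add_left inner_add_right inner_commute[of y x] power2_eq_square algebra_simps)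
qed

text \<open>Compactness of the unit sphere of \<open>S\<close>, which \<open>w\<close> shows to be
  nonempty. The relative form serves both the whole space and the plane orthogonal to the first
  axis.\<close>

lemma sum_inner_sq_attains_max_on_subspace:
  fixes r :: "nat \<Rightarrow> 'a :: euclidean_space"
  assumes "subspace S" "w \<in> S" "w \<noteq> 0"
  obtains e where "e \<in> S" "norm e = 1"
    "\<And>x. x \<in> S \<Longrightarrow> norm x = 1 \<Longrightarrow> (\<Sum>j<n. (inner (r j) x)\<^sup>2) \<le> (\<Sum>j<n. (inner (r j) e)\<^sup>2)"
proof -
  have "compact (S \<inter> sphere 0 1)"
    using assms(1) by (simp add: closed_Int_compact closed_subspace)
  moreover have "(1 / norm w) *\<^sub>R w \<in> S \<inter> sphere 0 1"
    using assms by (auto simp: subspace_scale)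
  moreover have "continuous_on (S \<inter> sphere 0 1) (\<lambda>x. \<Sum>j<n. (inner (r j) x)\<^sup>2)"
    by (intro continuous_intros)
  ultimately obtain e where "e \<in> S \<inter> sphere 0 1"
      "\<forall>x\<in>S \<inter> sphere 0 1. (\<Sum>j<n. (inner (r j) x)\<^sup>2) \<le> (\<Sum>j<n. (inner (r j) e)\<^sup>2)"
    using continuous_attains_sup[of "S \<inter> sphere 0 1"] by blast
  then show ?thesis
    by (intro that[of e]) auto
qed

text \<open>First-order condition at a maximizer, without derivatives: moving from \<open>e\<close>
  by \<open>t *\<^sub>R w\<close> changes the form to first order by \<open>2 * t * b\<close>, while
  the normalization costs only order \<open>t\<^sup>2\<close>, so \<open>b\<close> must
  vanish.\<close>

lemma sum_inner_sq_maximizer_orthogonal: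
  fixes r :: "nat \<Rightarrow> 'a :: euclidean_space"
  assumes S: "subspace S" "e \<in> S" "w \<in> S" and e: "norm e = 1" "inner e w = 0"
    and max: "\<And>x. x \<in> S \<Longrightarrow> norm x = 1 \<Longrightarrow> (\<Sum>j<n. (inner (r j) x)\<^sup>2) \<le> (\<Sum>j<n. (inner (r j) e)\<^sup>2)"
  shows "(\<Sum>j<n. inner (r j) e * inner (r j) w) = 0"
proof -
  define q where "q x = (\<Sum>j<n. (inner (r j) x)\<^sup>2)" for x
  define b where "b = (\<Sum>j<n. inner (r j) e * inner (r j) w)"
  have hom: "q x \<le> q e * (norm x)\<^sup>2" if "x \<in> S" for x
  proof (cases "x = 0")
    case False
    have "q ((1 / norm x) *\<^sub>R x) \<le> q e"
      unfolding q_def using that False S by (intro max) (auto simp: subspace_scale)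
    moreover have "q ((1 / norm x) *\<^sub>R x) = q x / (norm x)\<^sup>2"
      by (simp add: q_def power_divide sum_divide_distrib)
    ultimately show ?thesis
      using False by (simp add: divide_simps)
  qed (simp add: q_def)
  have quad: "2 * t * b \<le> t\<^sup>2 * (q e * (norm w)\<^sup>2 - q w)" for t
  proof -
    have "q (e + t *\<^sub>R w) \<le> q e * (norm (e + t *\<^sub>R w))\<^sup>2"
      by (rule hom) (use S in \<open>auto intro: subspace_add subspace_scale\<close>)
    moreover have "(norm (e + t *\<^sub>R w))\<^sup>2 = 1 + t\<^sup>2 * (norm w)\<^sup>2"
      using e norm_add_Pythagorean[of e "t *\<^sub>R w"]
      by (simp add: real_inner_class.orthogonal_def power_mult_distrib)
    moreover have "q (e + t *\<^sub>R w) = q e + 2 * t * b + t\<^sup>2 * q w"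
      unfolding q_def b_def sum_distrib_left sum.distrib[symmetric]
      by (intro sum.cong) (auto simp: inner_add_right power2_eq_square algebra_simps)
    ultimately show ?thesis
      by (simp add: algebra_simps)
  qed
  define c where "c = q e * (norm w)\<^sup>2 - q w"
  have "c \<ge> 0" using hom[OF S(3)] by (simp add: c_def)
  \<comment> \<open>With this \<open>t\<close> the bound
    \<open>2 * t * b \<le> t\<^sup>2 * c\<close> becomes \<open>t\<^sup>2 * (c + 2) \<le> 0\<close>.
    The added 1 keeps the denominator positive when \<open>c = 0\<close>.\<close>
  define t where "t = b / (c + 1)"
  have b: "b = t * (c + 1)" using \<open>c \<ge> 0\<close> by (simp add: t_def)
  have "2 * t * b \<le> t\<^sup>2 * c"
    unfolding c_def by (rule quad)
  then have "t\<^sup>2 * (c + 2) \<le> 0"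
    by (simp add: b power2_eq_square algebra_simps)
  then have "t = 0" using \<open>c \<ge> 0\<close> by (simp add: mult_le_0_iff)
  then show ?thesis using b by (simp add: b_def)
qed

text \<open>Successive maximization in place of the spectral theorem: \<open>a\<close> is maximal on
  the sphere, \<open>b\<close> on the circle orthogonal to \<open>a\<close>, and
  \<open>c = cross3 a b\<close> completes the basis. As \<open>c\<close> lies on that circle too,
  its value is at most that of \<open>b\<close>.\<close>

lemma gram_principal_axes:
  fixes r :: "nat \<Rightarrow> real^3"
  obtains a b c :: "real^3" where "norm a = 1"
    "\<forall>x y. inner x y = inner x a * inner y a + inner x b * inner y b + inner x c * inner y c"
    "\<forall>x. norm x = 1 \<longrightarrow> (\<Sum>j<n. (inner (r j) x)\<^sup>2) \<le> (\<Sum>j<n. (inner (r j) a)\<^sup>2)"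
    "(\<Sum>j<n. (inner (r j) b)\<^sup>2) \<le> (\<Sum>j<n. (inner (r j) a)\<^sup>2)"
    "(\<Sum>j<n. (inner (r j) c)\<^sup>2) \<le> (\<Sum>j<n. (inner (r j) b)\<^sup>2)"
    "(\<Sum>j<n. inner (r j) a * inner (r j) b) = 0"
    "(\<Sum>j<n. inner (r j) a * inner (r j) c) = 0"
    "(\<Sum>j<n. inner (r j) b * inner (r j) c) = 0"
proof -
  obtain a where a: "norm a = 1"
      "\<And>x. norm x = 1 \<Longrightarrow> (\<Sum>j<n. (inner (r j) x)\<^sup>2) \<le> (\<Sum>j<n. (inner (r j) a)\<^sup>2)"
    using sum_inner_sq_attains_max_on_subspace[where S = UNIV and w = "axis 1 1" and n = n and r = r]
    by (auto simp: axis_eq_0_iff)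
  let ?S = "{x. inner a x = 0}"
  have S: "subspace ?S" by (rule subspace_hyperplane)
  obtain u where "cross3 a u \<noteq> 0"
    using cross_basis_nonzero[of a] a(1) by fastforce
  then obtain b where b: "b \<in> ?S" "norm b = 1"
      "\<And>x. x \<in> ?S \<Longrightarrow> norm x = 1 \<Longrightarrow> (\<Sum>j<n. (inner (r j) x)\<^sup>2) \<le> (\<Sum>j<n. (inner (r j) b)\<^sup>2)"
    using sum_inner_sq_attains_max_on_subspace[OF S, where w = "cross3 a u" and n = n and r = r] dot_cross_self by auto
  define c where "c = cross3 a b"
  have c: "inner a c = 0" "inner b c = 0"
    by (simp_all add: c_def dot_cross_self)
  have nc: "norm c = 1"
    using norm_cross_dot[of a b] a(1) b(1,2)
    by (simp add: c_def power2_eq_1_iff) (smt (verit) norm_ge_zero)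
  show ?thesis
  proof
    show "\<forall>x y. inner x y = inner x a * inner y a + inner x b * inner y b + inner x c * inner y c"
      unfolding c_def using a(1) b(1,2) by (intro allI orthonormal_cross_inner) auto
    show "(\<Sum>j<n. inner (r j) a * inner (r j) b) = 0" "(\<Sum>j<n. inner (r j) a * inner (r j) c) = 0"
      using a b(1) c(1) by (auto intro!: sum_inner_sq_maximizer_orthogonal[of UNIV])
    show "(\<Sum>j<n. inner (r j) b * inner (r j) c) = 0"
      using S b c by (intro sum_inner_sq_maximizer_orthogonal[of ?S]) auto
  qed (use a b c nc in auto)
qed

section \<open>Spectrum of the Gram matrix\<close>

text \<open>Row \<open>j\<close> of \<open>A\<close> holds the coordinates of \<open>r j\<close>
  along the \<open>e i\<close>. Parseval makes \<open>A * B\<close> the Gram matrix, and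
  \<open>orth\<close> makes \<open>B * A\<close> diagonal, so its characteristic polynomial can be
  read off.\<close>

lemma gram_char_poly:
  fixes r :: "nat \<Rightarrow> 'a :: euclidean_space" and e :: "nat \<Rightarrow> 'a"
  assumes parseval: "\<And>x y. inner x y = (\<Sum>i<m. inner x (e i) * inner y (e i))"
    and orth: "\<And>i k. i < m \<Longrightarrow> k < m \<Longrightarrow> i \<noteq> k \<Longrightarrow> (\<Sum>j<n. inner (r j) (e i) * inner (r j) (e k)) = 0"
  shows "[:0, 1:] ^ m * char_poly (Matrix.mat n n (\<lambda>(k, l). inner (r k) (r l)))
           = [:0, 1:] ^ n * (\<Prod>i<m. [:- (\<Sum>j<n. (inner (r j) (e i))\<^sup>2), 1:])"
proof -
  define A where "A = Matrix.mat n m (\<lambda>(j, i). inner (r j) (e i))"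
  have A: "A \<in> carrier_mat n m" by (simp add: A_def)
  define B where "B = transpose_mat A"
  have B: "B \<in> carrier_mat m n" using A by (simp add: B_def)
  have AB: "A * B = Matrix.mat n n (\<lambda>(k, l). inner (r k) (r l))"
    by (intro eq_matI) (auto simp: A_def B_def scalar_prod_def parseval[of "r _" "r _"] atLeast0LessThan)
  have BA: "(B * A) $$ (i, k) = (\<Sum>j<n. inner (r j) (e i) * inner (r j) (e k))" if "i < m" "k < m" for i k
    using that by (auto simp: A_def B_def scalar_prod_def atLeast0LessThan)
  have "upper_triangular (B * A)"
    using A B by (auto simp: BA orth upper_triangular_def simp del: index_mult_mat(1))
  moreover have "B * A \<in> carrier_mat m m" using A B by auto
  ultimately have "char_poly (B * A) = (\<Prod>a\<leftarrow>diag_mat (B * A). [:- a, 1:])"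
    by (intro char_poly_upper_triangular)
  also have "diag_mat (B * A) = map (\<lambda>i. \<Sum>j<n. (inner (r j) (e i))\<^sup>2) [0..<m]"
    using A B by (auto simp: diag_mat_def BA power2_eq_square simp del: index_mult_mat(1))
  also have "(\<Prod>a\<leftarrow>\<dots>. [:- a, 1:]) = (\<Prod>i<m. [:- (\<Sum>j<n. (inner (r j) (e i))\<^sup>2), 1:])"
    by (simp add: prod.list_conv_set_nth atLeast0LessThan)
  finally show ?thesis
    using char_poly_mult_commute[OF A B] by (simp add: AB)
qed

text \<open>Comparing the roots in \<open>cp\<close> with multiplicity shows that the spectrum of
  \<open>A\<close> is \<open>x\<close>, \<open>y\<close>, \<open>z\<close> up to the number of
  zeros.\<close>

lemma eigenvalue_desc_2_plus_3:
  fixes A :: "real Matrix.mat"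
  assumes A: "A \<in> carrier_mat n n" and n: "2 \<le> n"
    and cp: "[:0, 1:] ^ 3 * char_poly A = [:0, 1:] ^ n * ([:- x, 1:] * [:- y, 1:] * [:- z, 1:])"
    and ord: "x \<ge> y" "y \<ge> z" "z \<ge> 0"
  shows "eigenvalue_desc 2 A + eigenvalue_desc 3 A = y + z"
proof -
  have "char_poly A \<noteq> 0"
    using degree_monic_char_poly[OF A] by auto
  then have "proots ([:0, 1:] ^ 3 * char_poly A) = replicate_mset 3 0 + proots (char_poly A)"
    by (simp add: proots_mult proots_power)
  moreover have "proots ([:0, 1:] ^ n * ([:- x, 1:] * [:- y, 1:] * [:- z, 1:]))
      = replicate_mset n 0 + {#x, y, z#}"
    by (simp add: proots_mult proots_power del: mult_pCons_left mult_pCons_right)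
  ultimately have roots: "replicate_mset 3 0 + proots (char_poly A) = replicate_mset n 0 + {#x, y, z#}"
    unfolding cp by simp
  show ?thesis
  proof (cases "n = 2")
    case True
    then have *: "{#0#} + proots (char_poly A) = {#x, y, z#}"
      using roots by (simp add: numeral_eq_Suc)
    \<comment> \<open>For \<open>n = 2\<close> one of the three values is surplus and must be zero.
      Since \<open>z\<close> is the smallest, it can be taken as that one, in agreement with the
      default value 0 of \<open>eigenvalue_desc 3\<close>.\<close>
    then have "0 \<in># {#x, y, z#}"
      by (metis union_single_eq_member add_mset_add_single union_commute)
    then have "z = 0" using ord by auto
    then have "proots (char_poly A) = mset [y, x]"
      using * by (simp add: add_mset_commute)
    then have "sorted_list_of_multiset (proots (char_poly A)) = [y, x]"
      using ord by (simp add: sorted_list_of_multiset_mset)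
    then show ?thesis
      using A True \<open>z = 0\<close> by (simp add: eigenvalue_desc_def)
  next
    case False
    define k where "k = n - 3"
    have k: "n = 3 + k" using n False by (simp add: k_def)
    have "proots (char_poly A) = replicate_mset k 0 + {#x, y, z#}"
      using roots by (simp add: k numeral_eq_Suc)
    also have "\<dots> = mset (replicate k 0 @ [z, y, x])"
      by (simp add: add_mset_commute)
    \<comment> \<open>By nonnegativity the padding zeros come first in ascending order, so the
      reversed list starts with \<open>x\<close>, \<open>y\<close>, \<open>z\<close>.\<close>
    finally have "sorted_list_of_multiset (proots (char_poly A)) = replicate k 0 @ [z, y, x]"
      using ord by (simp only: sorted_list_of_multiset_mset)
        (intro sorted_sort_id, auto simp: sorted_append)
    then show ?thesis
      using A by (simp add: eigenvalue_desc_def k)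
  qed
qed

text \<open>The two eigenvalues enter as the trace minus the largest one, which is the value of the
  form at the first principal axis \<open>a\<close>. Being the largest of three, that value is at
  least a third of the trace.\<close>

lemma gram_eigenvalues:
  fixes r :: "nat \<Rightarrow> real^3"
  assumes "2 \<le> n"
  defines "G \<equiv> Matrix.mat n n (\<lambda>(k, l). inner (r k) (r l))"
  obtains a where "norm a = 1"
    "\<And>x. norm x = 1 \<Longrightarrow> (\<Sum>j<n. (inner (r j) x)\<^sup>2) \<le> (\<Sum>j<n. (inner (r j) a)\<^sup>2)"
    "eigenvalue_desc 2 G + eigenvalue_desc 3 G = (\<Sum>j<n. (norm (r j))\<^sup>2) - (\<Sum>j<n. (inner (r j) a)\<^sup>2)"
    "(\<Sum>j<n. (norm (r j))\<^sup>2) \<le> 3 * (\<Sum>j<n. (inner (r j) a)\<^sup>2)"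
proof -
  obtain a b c :: "real^3" where abc: "norm a = 1"
    "\<forall>x y. inner x y = inner x a * inner y a + inner x b * inner y b + inner x c * inner y c"
    "\<forall>x. norm x = 1 \<longrightarrow> (\<Sum>j<n. (inner (r j) x)\<^sup>2) \<le> (\<Sum>j<n. (inner (r j) a)\<^sup>2)"
    "(\<Sum>j<n. (inner (r j) b)\<^sup>2) \<le> (\<Sum>j<n. (inner (r j) a)\<^sup>2)"
    "(\<Sum>j<n. (inner (r j) c)\<^sup>2) \<le> (\<Sum>j<n. (inner (r j) b)\<^sup>2)"
    "(\<Sum>j<n. inner (r j) a * inner (r j) b) = 0"
    "(\<Sum>j<n. inner (r j) a * inner (r j) c) = 0"
    "(\<Sum>j<n. inner (r j) b * inner (r j) c) = 0"
    by (rule gram_principal_axes[where n = n and r = r])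
  have "[:0, 1:] ^ 3 * char_poly G = [:0, 1:] ^ n * (\<Prod>i<3. [:- (\<Sum>j<n. (inner (r j) ([a, b, c] ! i))\<^sup>2), 1:])"
    unfolding G_def
  proof (rule gram_char_poly)
    show "inner x y = (\<Sum>i<3. inner x ([a, b, c] ! i) * inner y ([a, b, c] ! i))" for x y
      by (simp add: abc(2)[rule_format, of x y] numeral_eq_Suc)
    show "(\<Sum>j<n. inner (r j) ([a, b, c] ! i) * inner (r j) ([a, b, c] ! k)) = 0"
      if "i < 3" "k < 3" "i \<noteq> k" for i k
      using that abc(6-8) by (auto simp: numeral_eq_Suc less_Suc_eq mult.commute)
  qed
  then have cp: "[:0, 1:] ^ 3 * char_poly G = [:0, 1:] ^ n * ([:- (\<Sum>j<n. (inner (r j) a)\<^sup>2), 1:]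
      * [:- (\<Sum>j<n. (inner (r j) b)\<^sup>2), 1:] * [:- (\<Sum>j<n. (inner (r j) c)\<^sup>2), 1:])"
    by (simp add: numeral_eq_Suc)
  have square: "(norm (r j))\<^sup>2 = (inner (r j) a)\<^sup>2 + (inner (r j) b)\<^sup>2 + (inner (r j) c)\<^sup>2" for j
    unfolding power2_norm_eq_inner using abc(2)[rule_format, of "r j" "r j"]
    by (simp only: power2_eq_square)
  have "eigenvalue_desc 2 G + eigenvalue_desc 3 G
      = (\<Sum>j<n. (inner (r j) b)\<^sup>2) + (\<Sum>j<n. (inner (r j) c)\<^sup>2)"
    by (rule eigenvalue_desc_2_plus_3[OF _ assms(1) cp abc(4,5)]) (auto simp: G_def intro: sum_nonneg)
  moreover have "(\<Sum>j<n. (norm (r j))\<^sup>2) = (\<Sum>j<n. (inner (r j) a)\<^sup>2)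
      + (\<Sum>j<n. (inner (r j) b)\<^sup>2) + (\<Sum>j<n. (inner (r j) c)\<^sup>2)"
    unfolding sum.distrib[symmetric]
    by (intro sum.cong) (simp_all add: square)
  ultimately show ?thesis
    using abc(1,3,4,5) by (intro that[of a]) auto
qed

section \<open>Bloch vectors and robustness of coherence of one qubit\<close>

text \<open>Hermiticity and unit trace leave three real parameters, and positivity confines them to
  the unit ball. This shows that the description defining \<open>bloch_vector\<close> has exactly
  one solution.\<close>

lemma density_matrix_bloch:
  assumes "density_matrix \<rho>"
  shows "dagger \<rho> = \<rho>" "\<rho> $ 1 $ 1 + \<rho> $ 2 $ 2 = 1" "norm (bloch_vector \<rho>) \<le> 1"
    "\<rho> $ 1 $ 1 = of_real ((1 + bloch_vector \<rho> $ 3) / 2)"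
    "\<rho> $ 2 $ 2 = of_real ((1 - bloch_vector \<rho> $ 3) / 2)"
    "\<rho> $ 1 $ 2 = Complex (bloch_vector \<rho> $ 1 / 2) (- bloch_vector \<rho> $ 2 / 2)"
    "\<rho> $ 2 $ 1 = Complex (bloch_vector \<rho> $ 1 / 2) (bloch_vector \<rho> $ 2 / 2)"
proof -
  show herm: "dagger \<rho> = \<rho>"
    using assms by (simp add: density_matrix_def positive_semidefinite_def)
  show tr: "\<rho> $ 1 $ 1 + \<rho> $ 2 $ 2 = 1"
    using assms by (simp add: density_matrix_def Determinants.trace_def sum_2)
  have psd: "0 \<le> Re (\<Sum>i\<in>UNIV. cnj (v $ i) * (\<rho> *v v) $ i)" for v
    using assms by (simp add: density_matrix_def positive_semidefinite_def)
  have h: "cnj (\<rho> $ j $ i) = \<rho> $ i $ j" for i j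
    using herm by (simp add: dagger_def Finite_Cartesian_Product.vec_eq_iff)
  define x y z where "x = 2 * Re (\<rho> $ 1 $ 2)" and "y = - 2 * Im (\<rho> $ 1 $ 2)"
    and "z = Re (\<rho> $ 1 $ 1) - Re (\<rho> $ 2 $ 2)"
  have im: "Im (\<rho> $ 1 $ 1) = 0" "Im (\<rho> $ 2 $ 2) = 0"
    using h[of 1 1] h[of 2 2] by (auto simp: complex_eq_iff)
  have e11: "\<rho> $ 1 $ 1 = of_real ((1 + z) / 2)" and e22: "\<rho> $ 2 $ 2 = of_real ((1 - z) / 2)"
    using im arg_cong[OF tr, of Re] by (auto simp: complex_eq_iff z_def)
  have e12: "\<rho> $ 1 $ 2 = Complex (x / 2) (- y / 2)" by (simp add: x_def y_def)
  have e21: "\<rho> $ 2 $ 1 = Complex (x / 2) (y / 2)" using h[of 1 2] by (simp add: x_def y_def complex_eq_iff)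
  have q: "0 \<le> Re (cnj p * (\<rho> $ 1 $ 1 * p + \<rho> $ 1 $ 2 * q) + cnj q * (\<rho> $ 2 $ 1 * p + \<rho> $ 2 $ 2 * q))" for p q
    using psd[of "vector [p, q]"] by (simp add: sum_2 matrix_vector_mult_def)
  define d where "d = 1 - (x\<^sup>2 + y\<^sup>2 + z\<^sup>2)"
  \<comment> \<open>Testing positivity on the columns of the adjugate gives each diagonal entry times \<open>det \<rho> = d / 4\<close>.\<close>
  have "0 \<le> (1 + z) * d / 8"
    using q[of "Complex (- x / 2) (y / 2)" "of_real ((1 + z) / 2)"] unfolding e11 e12 e21 e22
    by (simp add: d_def power2_eq_square algebra_simps add_divide_distrib diff_divide_distrib)
  moreover have "0 \<le> (1 - z) * d / 8"
    using q[of "of_real ((1 - z) / 2)" "Complex (- x / 2) (- y / 2)"] unfolding e11 e12 e21 e22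
    by (simp add: d_def power2_eq_square algebra_simps add_divide_distrib diff_divide_distrib)
  \<comment> \<open>The diagonal entries add up to 1, so summing the two bounds removes them,
    whether or not one of them is zero.\<close>
  ultimately have "0 \<le> d"
    by (simp add: left_diff_distrib distrib_right)
  moreover define r where "r = (vector [x, y, z] :: real^3)"
  ultimately have r: "norm r \<le> 1"
    by (simp add: d_def norm_vec_def L2_set_def sum_3)
  have "bloch_vector \<rho> = r"
    unfolding bloch_vector_def
  proof (rule the_equality)
    show "norm r \<le> 1 \<and> \<rho> = (1 / 2) *\<^sub>R (Finite_Cartesian_Product.mat 1
            + (r $ 1) *\<^sub>R pauli_x + (r $ 2) *\<^sub>R pauli_y + (r $ 3) *\<^sub>R pauli_z)"
      using r by (simp add: Finite_Cartesian_Product.vec_eq_iff forall_2 e11 e12 e21 e22 pauli_x_def pauli_y_def pauli_z_def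
          Finite_Cartesian_Product.mat_def r_def complex_eq_iff)
    fix s :: "real^3"
    assume s: "norm s \<le> 1 \<and> \<rho> = (1 / 2) *\<^sub>R (Finite_Cartesian_Product.mat 1
            + (s $ 1) *\<^sub>R pauli_x + (s $ 2) *\<^sub>R pauli_y + (s $ 3) *\<^sub>R pauli_z)"
    show "s = r"
      by (simp add: Finite_Cartesian_Product.vec_eq_iff forall_3 r_def x_def y_def z_def)
        (simp add: s pauli_x_def pauli_y_def pauli_z_def Finite_Cartesian_Product.mat_def field_simps)
  qed
  then have b: "bloch_vector \<rho> $ 1 = x" "bloch_vector \<rho> $ 2 = y" "bloch_vector \<rho> $ 3 = z"
    and "norm (bloch_vector \<rho>) \<le> 1"
    using r by (simp_all add: r_def)
  then show "norm (bloch_vector \<rho>) \<le> 1"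
    "\<rho> $ 1 $ 1 = of_real ((1 + bloch_vector \<rho> $ 3) / 2)"
    "\<rho> $ 2 $ 2 = of_real ((1 - bloch_vector \<rho> $ 3) / 2)"
    "\<rho> $ 1 $ 2 = Complex (bloch_vector \<rho> $ 1 / 2) (- bloch_vector \<rho> $ 2 / 2)"
    "\<rho> $ 2 $ 1 = Complex (bloch_vector \<rho> $ 1 / 2) (bloch_vector \<rho> $ 2 / 2)"
    unfolding b by (simp_all only: e11 e22 e12 e21)
qed

text \<open>Twice this modulus is the length of the projection of the Bloch vector to the xy-plane.
  It limits how much coherence a weight \<open>s\<close> of \<open>\<tau>\<close> can
  cancel.\<close>

lemma density_matrix_off_diagonal:
  assumes "density_matrix \<tau>"
  shows "cmod (\<tau> $ 1 $ 2) \<le> 1 / 2"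
proof -
  note b = density_matrix_bloch[OF assms]
  have "sqrt ((bloch_vector \<tau> $ 1)\<^sup>2 + (bloch_vector \<tau> $ 2)\<^sup>2) \<le> norm (bloch_vector \<tau>)"
    by (simp add: norm_vec_def L2_set_def sum_3)
  moreover have "cmod (\<tau> $ 1 $ 2) = sqrt ((bloch_vector \<tau> $ 1)\<^sup>2 + (bloch_vector \<tau> $ 2)\<^sup>2) / 2"
    unfolding b(6) by (simp add: cmod_def power_divide add_divide_distrib[symmetric] real_sqrt_divide)
  ultimately show ?thesis using b(3) by linarith
qed

text \<open>Positivity is the inequality of arithmetic and geometric means for the moduli of the
  entries of \<open>v\<close>. These states supply the optimal \<open>\<tau>\<close> in the
  robustness.\<close>

lemma density_matrix_half_diagonal:
  assumes "cmod b \<le> 1 / 2"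
  shows "density_matrix (vector [vector [1 / 2, b], vector [cnj b, 1 / 2]])" (is "density_matrix ?\<tau>")
  unfolding density_matrix_def positive_semidefinite_def
proof (intro conjI allI)
  show "dagger ?\<tau> = ?\<tau>"
    by (simp add: dagger_def Finite_Cartesian_Product.vec_eq_iff forall_2)
  show "Determinants.trace ?\<tau> = 1"
    by (simp add: Determinants.trace_def sum_2)
  fix v :: "complex^2"
  define c where "c = cnj (v $ 1) * b * v $ 2"
  have "cmod c \<le> cmod (v $ 1) * cmod (v $ 2) / 2"
    using mult_left_mono[OF assms, of "cmod (v $ 1) * cmod (v $ 2)"]
    by (simp add: c_def norm_mult mult_ac)
  moreover have "- cmod c \<le> Re c"
    using abs_Re_le_cmod[of c] by linarith
  moreover have "2 * (cmod (v $ 1) * cmod (v $ 2)) \<le> (cmod (v $ 1))\<^sup>2 + (cmod (v $ 2))\<^sup>2"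
    using sum_squares_bound[of "cmod (v $ 1)" "cmod (v $ 2)"] by simp
  ultimately have "0 \<le> ((cmod (v $ 1))\<^sup>2 + (cmod (v $ 2))\<^sup>2) / 2 + 2 * Re c"
    by argo
  also have "\<dots> = Re (\<Sum>i\<in>UNIV. cnj (v $ i) * (?\<tau> *v v) $ i)"
    unfolding cmod_power2
    by (simp add: c_def sum_2 matrix_vector_mult_def power2_eq_square algebra_simps add_divide_distrib)
  finally show "0 \<le> Re (\<Sum>i\<in>UNIV. cnj (v $ i) * (?\<tau> *v v) $ i)" .
qed

lemma robustness_of_coherence_eq:
  assumes herm: "dagger A = A"
  shows "robustness_of_coherence A = 2 * cmod (A $ 1 $ 2)"
  unfolding robustness_of_coherence_def
proof (rule Least_equality)
  \<comment> \<open>Modulus 1/2 and phase opposite to \<open>A $ 1 $ 2\<close>, the most efficient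
    cancellation. If that entry is zero, division by zero gives \<open>b = 0\<close>, which is still
    admissible.\<close>
  define b where "b = - (A $ 1 $ 2) / of_real (2 * cmod (A $ 1 $ 2))"
  have "cmod b \<le> 1 / 2"
    by (simp add: b_def norm_divide norm_mult)
  then have "density_matrix (vector [vector [1 / 2, b], vector [cnj b, 1 / 2]])" (is "density_matrix ?\<tau>")
    by (rule density_matrix_half_diagonal)
  moreover have A21: "A $ 2 $ 1 = cnj (A $ 1 $ 2)"
    using arg_cong[OF herm, of "\<lambda>M. M $ 2 $ 1"] by (simp add: dagger_def)
  moreover have 12: "A $ 1 $ 2 + (2 * cmod (A $ 1 $ 2)) *\<^sub>R b = 0"
    by (simp add: b_def scaleR_conv_of_real)
  moreover have "cnj (A $ 1 $ 2) + (2 * cmod (A $ 1 $ 2)) *\<^sub>R cnj b = 0"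
    using arg_cong[OF 12, of cnj] by (simp add: scaleR_conv_of_real)
  ultimately show "0 \<le> 2 * cmod (A $ 1 $ 2) \<and> (\<exists>\<tau>. density_matrix \<tau> \<and>
      diagonal_matrix ((1 / (2 * cmod (A $ 1 $ 2) + 1)) *\<^sub>R (A + (2 * cmod (A $ 1 $ 2)) *\<^sub>R \<tau>)))"
    by (intro conjI exI[of _ ?\<tau>]) (auto simp: diagonal_matrix_def forall_2)
next
  fix s :: real
  assume "0 \<le> s \<and> (\<exists>\<tau>. density_matrix \<tau> \<and> diagonal_matrix ((1 / (s + 1)) *\<^sub>R (A + s *\<^sub>R \<tau>)))"
  then obtain \<tau> where s: "0 \<le> s" and \<tau>: "density_matrix \<tau>"
      and "((1 / (s + 1)) *\<^sub>R (A + s *\<^sub>R \<tau>)) $ 1 $ 2 = 0"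
    by (auto simp: diagonal_matrix_def)
  then have "A $ 1 $ 2 = - (s *\<^sub>R \<tau> $ 1 $ 2)"
    by (simp add: add_eq_0_iff2)
  then have "cmod (A $ 1 $ 2) = s * cmod (\<tau> $ 1 $ 2)"
    using s by simp
  then show "2 * cmod (A $ 1 $ 2) \<le> s"
    using mult_left_mono[OF density_matrix_off_diagonal[OF \<tau>] s] by simp
qed

section \<open>Unitary conjugation and the sphere of axes\<close>

text \<open>
  The Bloch vector of the pure state whose amplitudes are the conjugated first row of \<open>U\<close>, i.e. the
  axis that conjugation by \<open>U\<close> rotates to the \<open>z\<close>-axis.
\<close>

definition bloch_axis :: "complex^2^2 \<Rightarrow> real^3" where
  "bloch_axis U = vector [2 * Re (U $ 1 $ 1 * cnj (U $ 1 $ 2)), 2 * Im (U $ 1 $ 1 * cnj (U $ 1 $ 2)),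
              (cmod (U $ 1 $ 1))\<^sup>2 - (cmod (U $ 1 $ 2))\<^sup>2]"

lemma unitary_matrix_first_row:
  assumes "unitary_matrix U"
  shows "(cmod (U $ 1 $ 1))\<^sup>2 + (cmod (U $ 1 $ 2))\<^sup>2 = 1"
proof -
  have "(U ** dagger U) $ 1 $ 1 = 1"
    using assms by (simp add: unitary_matrix_def Finite_Cartesian_Product.mat_def)
  then have "complex_of_real ((cmod (U $ 1 $ 1))\<^sup>2 + (cmod (U $ 1 $ 2))\<^sup>2) = 1"
    unfolding of_real_add complex_norm_square
    by (simp add: matrix_matrix_mult_def sum_2 dagger_def)
  then show ?thesis using of_real_eq_1_iff by blast
qed

text \<open>The off-diagonal entry is not expanded: trace and determinant are invariant, so its
  squared modulus is \<open>A $ 1 $ 1 * (1 - A $ 1 $ 1)\<close> minus the determinant of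
  \<open>\<rho>\<close>, and only \<open>A $ 1 $ 1\<close> has to be computed.\<close>

lemma robustness_of_coherence_unitary:
  assumes \<rho>: "density_matrix \<rho>" and U: "unitary_matrix U"
  shows "robustness_of_coherence (U ** \<rho> ** dagger U)
      = sqrt ((norm (bloch_vector \<rho>))\<^sup>2 - (inner (bloch_vector \<rho>) (bloch_axis U))\<^sup>2)"
proof -
  note b = density_matrix_bloch[OF \<rho>]
  define A where "A = U ** \<rho> ** dagger U"
  have h: "cnj (\<rho> $ j $ i) = \<rho> $ i $ j" for i j
    using b(1) by (simp add: dagger_def Finite_Cartesian_Product.vec_eq_iff)
  have herm: "dagger A = A"
    by (simp add: A_def dagger_def Finite_Cartesian_Product.vec_eq_iff forall_2 matrix_matrix_mult_def sum_2 h)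
      (auto simp: algebra_simps)
  have det: "Determinants.det A = Determinants.det \<rho>"
  proof -
    have "Determinants.det U * Determinants.det (dagger U) = 1"
      using U by (simp add: unitary_matrix_def det_mul[symmetric])
    then show ?thesis
      by (simp add: A_def det_mul mult_ac)
  qed
  have tr: "A $ 1 $ 1 + A $ 2 $ 2 = 1"
  proof -
    have "Determinants.trace A = Determinants.trace (dagger U ** (U ** \<rho>))"
      unfolding A_def by (rule trace_mul_sym)
    also have "\<dots> = 1"
      using U \<rho> by (simp add: matrix_mul_assoc unitary_matrix_def density_matrix_def)
    finally show ?thesis by (simp add: Determinants.trace_def sum_2)
  qed
  let ?r = "bloch_vector \<rho>"
  \<comment> \<open>The squared norm of the first row stands in for 1, which makes this a polynomial
    identity in real and imaginary parts.\<close>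
  have "A $ 1 $ 1 = of_real (((cmod (U $ 1 $ 1))\<^sup>2 + (cmod (U $ 1 $ 2))\<^sup>2 + inner ?r (bloch_axis U)) / 2)"
    unfolding bloch_axis_def cmod_power2
    by (simp add: A_def matrix_matrix_mult_def sum_2 sum_3 dagger_def inner_vec_def b(4-7)
        complex_eq_iff power2_eq_square field_simps)
  then have A11: "A $ 1 $ 1 = of_real ((1 + inner ?r (bloch_axis U)) / 2)"
    by (simp only: unitary_matrix_first_row[OF U])
  have "A $ 2 $ 1 = cnj (A $ 1 $ 2)"
    using arg_cong[OF herm, of "\<lambda>M. M $ 2 $ 1"] by (simp add: dagger_def)
  then have "of_real ((cmod (A $ 1 $ 2))\<^sup>2) = A $ 1 $ 1 * (1 - A $ 1 $ 1) - Determinants.det \<rho>"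
    unfolding det[symmetric] Determinants.det_2[of A] complex_norm_square
    using tr by (simp add: eq_diff_eq[symmetric] add.commute)
  also have "\<dots> = of_real ((1 - (inner ?r (bloch_axis U))\<^sup>2) / 4 - (1 - (norm ?r)\<^sup>2) / 4)"
    unfolding A11 power2_norm_eq_inner
    by (simp add: Determinants.det_2 b(4-7) complex_eq_iff inner_vec_def sum_3 power2_eq_square field_simps)
  finally have "(2 * cmod (A $ 1 $ 2))\<^sup>2 = (norm ?r)\<^sup>2 - (inner ?r (bloch_axis U))\<^sup>2"
    unfolding of_real_eq_iff by (simp add: power_mult_distrib field_simps)
  then show ?thesis
    using robustness_of_coherence_eq[OF herm] by (metis A_def norm_ge_zero mult_nonneg_nonneg real_sqrt_unique zero_le_numeral)
qed

lemma norm_bloch_axis: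
  assumes "unitary_matrix U"
  shows "norm (bloch_axis U) = 1"
proof -
  have "(2 * Re (a * cnj b))\<^sup>2 + (2 * Im (a * cnj b))\<^sup>2 + ((cmod a)\<^sup>2 - (cmod b)\<^sup>2)\<^sup>2
      = ((cmod a)\<^sup>2 + (cmod b)\<^sup>2)\<^sup>2" for a b
    unfolding cmod_power2 by (simp add: power2_eq_square algebra_simps)
  then have "(2 * Re (U $ 1 $ 1 * cnj (U $ 1 $ 2)))\<^sup>2 + (2 * Im (U $ 1 $ 1 * cnj (U $ 1 $ 2)))\<^sup>2
      + ((cmod (U $ 1 $ 1))\<^sup>2 - (cmod (U $ 1 $ 2))\<^sup>2)\<^sup>2 = 1"
    by (simp only: unitary_matrix_first_row[OF assms] power_one)
  then have "inner (bloch_axis U) (bloch_axis U) = 1"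
    by (simp only: bloch_axis_def inner_vec_def sum_3 vector_3 inner_real_def power2_eq_square)
  then show ?thesis by (simp add: norm_eq_1)
qed

text \<open>A first row with real leading entry \<open>a\<close> suffices. The sum of the two norm
  equations in \<open>ab\<close> fixes \<open>a\<close>, and the first two components of
  \<open>u\<close> then fix \<open>b\<close>; only the south pole, where \<open>a = 0\<close>, is
  treated apart.\<close>

lemma bloch_axis_surj:
  assumes "norm u = 1"
  obtains U where "unitary_matrix U" "bloch_axis U = u"
proof -
  have u: "u $ 1 * u $ 1 + u $ 2 * u $ 2 + u $ 3 * u $ 3 = 1"
    using assms by (simp add: norm_eq_1 inner_vec_def sum_3)
  obtain a :: real and b :: complex where ab: "a\<^sup>2 + (cmod b)\<^sup>2 = 1" "2 * a * Re b = u $ 1"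
      "- 2 * a * Im b = u $ 2" "a\<^sup>2 - (cmod b)\<^sup>2 = u $ 3"
  proof (cases "u $ 3 = - 1")
    case True
    then have "u $ 1 * u $ 1 + u $ 2 * u $ 2 = 0" using u by simp
    then have "u $ 1 = 0" "u $ 2 = 0" by (simp_all add: sum_squares_eq_zero_iff)
    then show ?thesis using True by (intro that[of 0 1]) simp_all
  next
    case False
    have "u $ 3 * u $ 3 \<le> 1"
      using u zero_le_square[of "u $ 1"] zero_le_square[of "u $ 2"] by linarith
    then have "- 1 \<le> u $ 3"
      using abs_square_le_1[of "u $ 3"] by (simp add: power2_eq_square abs_le_iff)
    then have pos: "0 < 1 + u $ 3" using False by simp
    define a where "a = sqrt ((1 + u $ 3) / 2)"
    have a: "0 < a" "a\<^sup>2 = (1 + u $ 3) / 2" using pos by (simp_all add: a_def)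
    define b where "b = Complex (u $ 1 / (2 * a)) (- u $ 2 / (2 * a))"
    have "(cmod b)\<^sup>2 = (u $ 1 * u $ 1 + u $ 2 * u $ 2) / (4 * a\<^sup>2)"
      unfolding b_def cmod_power2
      by (simp add: power_divide power_mult_distrib add_divide_distrib power2_eq_square)
    also have "\<dots> = (1 - u $ 3) * (1 + u $ 3) / (4 * a\<^sup>2)"
      using u by (simp add: algebra_simps)
    also have "\<dots> = (1 - u $ 3) / 2"
      unfolding a(2) using pos by (simp add: field_simps)
    finally have b: "(cmod b)\<^sup>2 = (1 - u $ 3) / 2" .
    show ?thesis
    proof (rule that[of a b])
      show "a\<^sup>2 + (cmod b)\<^sup>2 = 1" "a\<^sup>2 - (cmod b)\<^sup>2 = u $ 3"
        unfolding a(2) b by argo+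
      show "2 * a * Re b = u $ 1" "- 2 * a * Im b = u $ 2"
        using a(1) by (simp_all add: b_def)
    qed
  qed
  define U :: "complex^2^2" where "U = vector [vector [of_real a, b], vector [- cnj b, of_real a]]"
  have "of_real a * of_real a + b * cnj b = (1 :: complex)"
    using arg_cong[OF ab(1), of complex_of_real] unfolding of_real_add complex_norm_square
    by (simp add: power2_eq_square)
  then have "unitary_matrix U"
    unfolding unitary_matrix_def
    by (simp add: U_def dagger_def Finite_Cartesian_Product.vec_eq_iff forall_2 sum_2
        matrix_matrix_mult_def Finite_Cartesian_Product.mat_def mult.commute add.commute)
  moreover have "bloch_axis U = u"
    using ab(2-4) by (simp add: Finite_Cartesian_Product.vec_eq_iff forall_3 bloch_axis_def U_def)
  ultimately show ?thesis by (rule that)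
qed

section \<open>Minimization over axes and the final bounds\<close>

text \<open>\<open>bloch_axis\<close> maps the unitaries onto the unit sphere, so the minimum
  becomes that of a continuous function on a compact set. Attainment is what gives the
  \<open>LEAST\<close> in the definition its value.\<close>

lemma set_coherence_R1_attained:
  assumes "\<forall>j<n. density_matrix (\<rho> j)"
  defines "F \<equiv> \<lambda>u. (1 / real n) * (\<Sum>j<n. sqrt ((norm (bloch_vector (\<rho> j)))\<^sup>2 - (inner (bloch_vector (\<rho> j)) u)\<^sup>2))"
  obtains v where "norm v = 1" "set_coherence_R1 n \<rho> = F v"
    "\<And>u. norm u = 1 \<Longrightarrow> set_coherence_R1 n \<rho> \<le> F u"
proof -
  have F: "(1 / real n) * (\<Sum>j<n. robustness_of_coherence (U ** \<rho> j ** dagger U)) = F (bloch_axis U)"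
    if "unitary_matrix U" for U
    unfolding F_def using that assms(1) by (simp add: robustness_of_coherence_unitary)
  have "continuous_on (sphere 0 1) F"
    unfolding F_def by (intro continuous_intros)
  moreover have "sphere (0 :: real^3) 1 \<noteq> {}" by simp
  ultimately obtain v where v: "norm v = 1" "\<And>u. norm u = 1 \<Longrightarrow> F v \<le> F u"
    using continuous_attains_inf[OF compact_sphere, of "0 :: real^3" 1 F] by auto
  have "set_coherence_R1 n \<rho> = F v"
    unfolding set_coherence_R1_def
  proof (rule Least_equality)
    obtain U where "unitary_matrix U" "bloch_axis U = v"
      using bloch_axis_surj v(1) by blast
    then show "\<exists>U. unitary_matrix U \<and>
        F v = (1 / real n) * (\<Sum>j<n. robustness_of_coherence (U ** \<rho> j ** dagger U))"
      using F by metis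
    show "F v \<le> c" if "\<exists>U. unitary_matrix U \<and>
        c = (1 / real n) * (\<Sum>j<n. robustness_of_coherence (U ** \<rho> j ** dagger U))" for c
      using that F norm_bloch_axis v(2) by metis
  qed
  then show ?thesis
    using v by (intro that[of v]) auto
qed

theorem mainTheorem5:
  fixes n :: nat and \<rho> :: "nat \<Rightarrow> complex^2^2"
  assumes "2 \<le> n"
    and "\<forall>j<n. density_matrix (\<rho> j)"
  shows "(eigenvalue_desc 2 (bloch_gram n \<rho>) + eigenvalue_desc 3 (bloch_gram n \<rho>)) / real n
           \<le> set_coherence_R1 n \<rho>
       \<and> set_coherence_R1 n \<rho>
           \<le> sqrt ((eigenvalue_desc 2 (bloch_gram n \<rho>) + eigenvalue_desc 3 (bloch_gram n \<rho>)) / real n)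
       \<and> set_coherence_R1 n \<rho> \<le> sqrt (2 / 3)"
proof -
  define r where "r j = bloch_vector (\<rho> j)" for j
  define x where "x u j = (norm (r j))\<^sup>2 - (inner (r j) u)\<^sup>2" for u j
  define S where "S = eigenvalue_desc 2 (bloch_gram n \<rho>) + eigenvalue_desc 3 (bloch_gram n \<rho>)"
  have n: "0 < real n" using assms(1) by simp
  obtain a where a: "norm a = 1"
      "\<And>u. norm u = 1 \<Longrightarrow> (\<Sum>j<n. (inner (r j) u)\<^sup>2) \<le> (\<Sum>j<n. (inner (r j) a)\<^sup>2)"
      "S = (\<Sum>j<n. (norm (r j))\<^sup>2) - (\<Sum>j<n. (inner (r j) a)\<^sup>2)"
      "(\<Sum>j<n. (norm (r j))\<^sup>2) \<le> 3 * (\<Sum>j<n. (inner (r j) a)\<^sup>2)"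
    using gram_eigenvalues[OF assms(1), of r] unfolding S_def bloch_gram_def r_def by blast
  obtain v where v: "norm v = 1"
      "set_coherence_R1 n \<rho> = (1 / real n) * (\<Sum>j<n. sqrt (x v j))"
      "\<And>u. norm u = 1 \<Longrightarrow> set_coherence_R1 n \<rho> \<le> (1 / real n) * (\<Sum>j<n. sqrt (x u j))"
    using set_coherence_R1_attained[OF assms(2)] unfolding x_def r_def by blast
  have r: "(norm (r j))\<^sup>2 \<le> 1" if "j < n" for j
    using that assms(2) density_matrix_bloch(3) by (simp add: r_def power_le_one)
  have x0: "0 \<le> x u j" if "norm u = 1" for u j
    using Cauchy_Schwarz_ineq2[of "r j" u] that by (simp add: x_def abs_le_square_iff[symmetric])
  have x1: "x u j \<le> 1" if "j < n" for u j
    using r[OF that] zero_le_power2[of "inner (r j) u"] unfolding x_def by linarith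
  have sumx: "(\<Sum>j<n. x u j) = (\<Sum>j<n. (norm (r j))\<^sup>2) - (\<Sum>j<n. (inner (r j) u)\<^sup>2)" for u
    by (simp add: x_def sum_subtractf)
  \<comment> \<open>The axis \<open>a\<close> minimizes the sum of the \<open>x u j\<close>, with
    minimum \<open>S\<close>; the optimal axis \<open>v\<close> for the coherence may be a different
    one.\<close>
  have "S \<le> (\<Sum>j<n. x v j)"
    using a(2)[OF v(1)] unfolding sumx a(3) by linarith
  also have "\<dots> \<le> (\<Sum>j<n. sqrt (x v j))"
  proof (rule sum_mono)
    fix j assume "j \<in> {..<n}"
    then have "(x v j)\<^sup>2 \<le> x v j"
      using x0[OF v(1)] x1 by (simp add: power2_eq_square mult_left_le)
    then show "x v j \<le> sqrt (x v j)" by (rule real_le_rsqrt)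
  qed
  finally have lower: "S / real n \<le> set_coherence_R1 n \<rho>"
    unfolding v(2) using n by (simp add: divide_right_mono)
  \<comment> \<open>Cauchy-Schwarz at the trial axis \<open>a\<close>, where the
    \<open>x a j\<close> sum exactly to \<open>S\<close>.\<close>
  have "(\<Sum>j<n. sqrt (x a j))\<^sup>2 \<le> (\<Sum>j<n. (sqrt (x a j))\<^sup>2) * real n"
    using sum_squared_le_sum_of_squares[of "\<lambda>j. sqrt (x a j)" "{..<n}"] by simp
  also have "\<dots> = S * real n"
    using x0[OF a(1)] by (simp add: sumx a(3))
  finally have "((1 / real n) * (\<Sum>j<n. sqrt (x a j)))\<^sup>2 \<le> S / real n"
    using n by (simp add: power_mult_distrib power2_eq_square field_simps)
  then have "(1 / real n) * (\<Sum>j<n. sqrt (x a j)) \<le> sqrt (S / real n)"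
    by (rule real_le_rsqrt)
  then have upper: "set_coherence_R1 n \<rho> \<le> sqrt (S / real n)"
    using v(3)[OF a(1)] by linarith
  have "(\<Sum>j<n. (norm (r j))\<^sup>2) \<le> real n"
    using sum_mono[of "{..<n}" "\<lambda>j. (norm (r j))\<^sup>2" "\<lambda>_. 1"] r by simp
  \<comment> \<open>\<open>S\<close> is the trace less its largest eigenvalue, hence at most two
    thirds of the trace, which is at most \<open>n\<close>.\<close>
  then have "3 * S \<le> 2 * real n"
    using a(3,4) by linarith
  then have "sqrt (S / real n) \<le> sqrt (2 / 3)"
    using n by (simp add: field_simps)
  then show ?thesis
    using lower upper unfolding S_def by linarith
qed

end
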